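(* Let $B_{n,p}$ ($n,p\ge 0$) be the $p$-Bernoulli numbers. For every integer $p\ge 0$, the generating function $f_p(t)=\sum_{n\ge 0}B_{n,p}\frac{t^n}{n!}$ is given by $$f_p(t)=\frac{(p+1)\,t\,e^{pt}}{(e^t-1)^{p+1}}-(p+1)\sum_{k=1}^{p}\frac{1}{k}\,\frac{e^{(p-k)t}}{(e^t-1)^{p-k+1}},$$ and this expression coincides with $$\frac{(p+1)\,e^{pt}\,(t-H_p)}{(e^t-1)^{p+1}}+(p+1)\sum_{k=1}^{p}\binom{p}{k}\frac{H_k}{(e^t-1)^{k+1}}.$$
   Context: The Bernoulli numbers $B_n$ are defined by $\sum_{n\ge 0}B_n\frac{t^n}{n!}=\frac{t}{e^t-1}$. The $p$-Bernoulli numbers $B_{n,p}$, for integers $n,p\ge 0$, are the numbers satisfying $B_{0,p}=1$ for all $p\ge 0$, $B_{n,0}=B_n$ for all $n\ge 0$, and the recurrence relation $$B_{n+1,p}=p\,B_{n,p}-\frac{(p+1)^2}{p+2}\,B_{n,p+1},\qquad p\ge 0,\ n\ge 0.$$ $H_k=\sum_{j=1}^{k}\frac1j$ denotes the $k$-th harmonic number (with $H_0=0$). Empty sums are $0$. The identities are understood as identities of formal Laurent series in $t$. *)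

theory Defs
  imports "HOL-Analysis.Harmonic_Numbers" "HOL-Computational_Algebra.Formal_Laurent_Series"
begin

definition bernoulli_number :: "nat \<Rightarrow> real" where
  "bernoulli_number n = fact n * fps_nth (fps_X / (fps_exp 1 - 1)) n"

definition p_bernoulli_numbers :: "(nat \<Rightarrow> nat \<Rightarrow> real) \<Rightarrow> bool" where
  "p_bernoulli_numbers B \<longleftrightarrow>
     (\<forall>p. B 0 p = 1) \<and>
     (\<forall>n. B n 0 = bernoulli_number n) \<and>
     (\<forall>n p. B (Suc n) p = real p * B n p - (real p + 1)\<^sup>2 / (real p + 2) * B n (Suc p))"

definition p_bernoulli_egf :: "(nat \<Rightarrow> nat \<Rightarrow> real) \<Rightarrow> nat \<Rightarrow> real fps" where
  "p_bernoulli_egf B p = Abs_fps (\<lambda>n. B n p / fact n)"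

abbreviation fls_exp :: "real \<Rightarrow> real fls" where
  "fls_exp c \<equiv> fps_to_fls (fps_exp c)"

text \<open>
  The conditions in \<^const>\<open>p_bernoulli_numbers\<close> over-determine the array: the recurrence
  together with the values at \<open>p = 0\<close> already fixes it, and \<open>B 0 p = 1\<close> has to be compatible.
  The following lemmas show that exactly one array satisfies all of them. For existence,
  the generating function is the hypergeometric series \<open>F(1, 1; p + 2; 1 - exp t)\<close>.
\<close>

lemma p_bernoulli_numbers_unique:
  assumes "p_bernoulli_numbers B" "p_bernoulli_numbers C"
  shows "B = C"
proof -
  have "\<forall>n. B n p = C n p" for p
  proof (induction p)
    case 0
    then show ?case using assms by (simp add: p_bernoulli_numbers_def)
  next
    case (Suc p)
    have nz: "(real p + 1)\<^sup>2 / (real p + 2) \<noteq> 0"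
      by (simp add: add_nonneg_eq_0_iff)
    show ?case
    proof
      fix n
      have "B (Suc n) p = real p * B n p - (real p + 1)\<^sup>2 / (real p + 2) * B n (Suc p)"
        and "C (Suc n) p = real p * C n p - (real p + 1)\<^sup>2 / (real p + 2) * C n (Suc p)"
        using assms unfolding p_bernoulli_numbers_def by blast+
      then have "(real p + 1)\<^sup>2 / (real p + 2) * B n (Suc p)
               = (real p + 1)\<^sup>2 / (real p + 2) * C n (Suc p)"
        using Suc by (metis diff_eq_diff_eq diff_left_imp_eq)
      then show "B n (Suc p) = C n (Suc p)"
        using nz by (metis mult_left_cancel)
    qed
  qed
  then show ?thesis by blast
qed

lemma p_bernoulli_numbers_exists: "\<exists>B. p_bernoulli_numbers B"
proof -
  define E :: "real fps" where "E = fps_exp 1"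
  define G :: "nat \<Rightarrow> real fps"
    where "G p = Abs_fps (\<lambda>k. fact k * fact (p + 1) / fact (p + 1 + k))" for p
  define f where "f p = G p oo (1 - E)" for p
  define B where "B n p = fact n * fps_nth (f p) n" for n p
  have c0: "fps_nth (1 - E) 0 = 0" by (simp add: E_def)
  have G_rec: "(fps_X - 1) * fps_deriv (G p)
        = fps_const (real p) * G p - fps_const ((real p + 1)\<^sup>2 / (real p + 2)) * G (Suc p)" for p
  proof (rule fps_ext)
    fix k
    define g where "g = fps_nth (G p) k"
    have s1: "fps_nth (G p) (Suc k) = g * (real k + 1) / (real p + 2 + real k)"
      by (simp add: g_def G_def field_simps)
    have s2: "fps_nth (G (Suc p)) k = g * (real p + 2) / (real p + 2 + real k)"
      by (simp add: g_def G_def field_simps)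
    have l: "fps_nth ((fps_X - 1) * fps_deriv (G p)) k
        = real k * g - (real k + 1) * fps_nth (G p) (Suc k)"
      by (cases k) (simp_all add: algebra_simps g_def)
    have r: "fps_nth (fps_const (real p) * G p
          - fps_const ((real p + 1)\<^sup>2 / (real p + 2)) * G (Suc p)) k
        = real p * g - (real p + 1)\<^sup>2 / (real p + 2) * fps_nth (G (Suc p)) k"
      by (simp add: g_def)
    have d: "real p + 2 \<noteq> 0" "real p + 2 + real k \<noteq> 0" by linarith+
    have "real k * g - (real k + 1) * (g * (real k + 1) / (real p + 2 + real k))
        = real p * g - (real p + 1)\<^sup>2 / (real p + 2) * (g * (real p + 2) / (real p + 2 + real k))"
      using d by (simp add: divide_simps) (simp add: algebra_simps power2_eq_square)
    then show "fps_nth ((fps_X - 1) * fps_deriv (G p)) k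
        = fps_nth (fps_const (real p) * G p
          - fps_const ((real p + 1)\<^sup>2 / (real p + 2)) * G (Suc p)) k"
      unfolding l r s1 s2 .
  qed
  have f_rec: "fps_deriv (f p)
        = fps_const (real p) * f p - fps_const ((real p + 1)\<^sup>2 / (real p + 2)) * f (Suc p)" for p
  proof -
    have "fps_deriv (f p) = (fps_deriv (G p) oo (1 - E)) * fps_deriv (1 - E)"
      unfolding f_def using c0 by (rule fps_compose_deriv)
    also have "\<dots> = ((fps_X - 1) * fps_deriv (G p)) oo (1 - E)"
      using c0 by (simp add: fps_compose_mult_distrib fps_compose_sub_distrib E_def)
    also have "\<dots> = fps_const (real p) * f p
        - fps_const ((real p + 1)\<^sup>2 / (real p + 2)) * f (Suc p)"
      unfolding G_rec f_def
      using c0 by (simp add: fps_compose_mult_distrib fps_compose_sub_distrib)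
    finally show ?thesis .
  qed
  have f0: "f 0 = fps_X / (E - 1)"
  proof -
    define L where "L = fps_X * G 0"
    have "fps_deriv L = inverse (1 - fps_X)"
    proof -
      have "fps_deriv L = Abs_fps (\<lambda>_. 1)"
      proof (rule fps_ext)
        fix n
        have "fps_nth (fps_deriv L) n = real (Suc n) * (fact n / fact (Suc n))"
          by (simp add: L_def G_def add_divide_distrib algebra_simps del: fact_Suc)
        also have "\<dots> = 1"
          by (simp del: of_nat_Suc)
        finally show "fps_nth (fps_deriv L) n = fps_nth (Abs_fps (\<lambda>_. 1)) n" by simp
      qed
      then show ?thesis
        using fps_inverse_gp'[where ?'a = real] by (metis fps_inverse_idempotent fps_nth_Abs_fps one_neq_zero)
    qed
    then have "fps_deriv (L oo (1 - E)) = (inverse (1 - fps_X) oo (1 - E)) * fps_deriv (1 - E)"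
      using c0 by (simp add: fps_compose_deriv)
    also have "inverse (1 - fps_X) oo (1 - E) = inverse E"
      using c0 by (subst fps_inverse_compose) (simp_all add: fps_compose_sub_distrib)
    also have "inverse E * fps_deriv (1 - E) = - 1"
      using inverse_mult_eq_1[of E] by (simp add: E_def)
    finally have "fps_deriv (L oo (1 - E)) = fps_deriv (- fps_X)" by simp
    then have "L oo (1 - E) = - fps_X"
      unfolding fps_deriv_eq_iff by (simp add: L_def)
    then have "f 0 * (E - 1) = fps_X"
      using c0 unfolding L_def f_def
      by (simp add: fps_compose_mult_distrib algebra_simps)
    moreover have "E - 1 \<noteq> 0"
    proof
      assume "E - 1 = 0"
      then have "fps_nth (E - 1) 1 = 0" by simp
      then show False by (simp add: E_def)
    qed
    ultimately show ?thesis by (metis nonzero_mult_div_cancel_right)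
  qed
  have "p_bernoulli_numbers B"
    unfolding p_bernoulli_numbers_def
  proof (intro conjI allI)
    fix n p
    show "B 0 p = 1" by (simp add: B_def f_def G_def)
    show "B n 0 = bernoulli_number n"
      by (simp add: B_def f0 E_def bernoulli_number_def)
    have "real (Suc n) * fps_nth (f p) (Suc n)
        = real p * fps_nth (f p) n - (real p + 1)\<^sup>2 / (real p + 2) * fps_nth (f (Suc p)) n"
      using arg_cong[OF f_rec[of p], of "\<lambda>h. fps_nth h n"] by simp
    then have "fact n * (real (Suc n) * fps_nth (f p) (Suc n))
        = fact n * (real p * fps_nth (f p) n
            - (real p + 1)\<^sup>2 / (real p + 2) * fps_nth (f (Suc p)) n)" by simp
    then show "B (Suc n) p = real p * B n p - (real p + 1)\<^sup>2 / (real p + 2) * B n (Suc p)"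
      by (simp add: B_def algebra_simps)
  qed
  then show ?thesis by blast
qed

end

theory Submission
  imports Defs
begin

text \<open>
  Put \<open>u = e\<^sup>t - 1\<close>, \<open>v = 1 / u\<close> and \<open>w = e\<^sup>t / u = 1 + v\<close>. After division by \<open>p + 1\<close> the first
  closed form becomes \<open>g\<^sub>p = v (t w\<^sup>p - S\<^sub>p(w))\<close> with \<open>S\<^sub>p(w) = (\<Sum>k = 1..p. w\<^sup>p\<^sup>-\<^sup>k / k)\<close>, and the whole
  proof rests on the Horner rule \<open>S\<^sub>p\<^sub>+\<^sub>1(w) = w S\<^sub>p(w) + 1 / (p + 1)\<close>.

  For the generating function, the Horner rule says \<open>g\<^sub>p\<^sub>+\<^sub>1 = w g\<^sub>p - v / (p + 1)\<close>. Because
  \<open>w' = v' = - v w\<close>, induction on \<open>p\<close> turns this algebraic recurrence into the differential one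
  \<open>(p + 1) g\<^sub>p\<^sub>+\<^sub>1 = p g\<^sub>p - g\<^sub>p'\<close> (lemma \<open>closed_form_differential_recurrence\<close>). The
  recurrence that defines the \<open>p\<close>-Bernoulli numbers says the same about \<open>f\<^sub>p / (p + 1)\<close>, and \<open>f\<^sub>0 = t / u = g\<^sub>0\<close>; since each
  member of such a sequence determines the next one, \<open>f\<^sub>p = (p + 1) g\<^sub>p\<close> for all \<open>p\<close>.

  The second closed form is the first one with \<open>S\<^sub>p(1 + v)\<close> expanded in powers of \<open>v\<close> (lemma
  \<open>harmonic_poly_binomial\<close>), a polynomial identity which again follows from the Horner rule.
\<close>

section \<open>A binomial expansion with harmonic numbers\<close>

text \<open>
  The polynomial \<open>S\<^sub>p\<close>, a truncation of the logarithmic series: \<open>harmonic_poly p w / w ^ p\<close> is the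
  partial sum of \<open>- ln (1 - 1 / w)\<close>.
\<close>

definition harmonic_poly :: "nat \<Rightarrow> 'a :: field \<Rightarrow> 'a" where
  "harmonic_poly p w = (\<Sum>k = 1..p. w ^ (p - k) / of_nat k)"

lemma harmonic_poly_0 [simp]: "harmonic_poly 0 w = 0"
  by (simp add: harmonic_poly_def)

lemma harmonic_poly_Suc:
  "harmonic_poly (Suc p) w = w * harmonic_poly p w + 1 / of_nat (Suc p)"
proof -
  have "(\<Sum>k = 1..p. w ^ (Suc p - k) / of_nat k) = w * (\<Sum>k = 1..p. w ^ (p - k) / of_nat k)"
    unfolding sum_distrib_left by (intro sum.cong) (auto simp: Suc_diff_le)
  then show ?thesis
    by (simp add: harmonic_poly_def)
qed

text \<open>
  A version of \<^const>\<open>harm\<close> over an arbitrary field, in order to speak about Laurent series, which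
  are not a normed field.
\<close>

definition harmonic :: "nat \<Rightarrow> 'a :: field" where
  "harmonic n = (\<Sum>k = 1..n. 1 / of_nat k)"

lemma harmonic_Suc: "harmonic (Suc n) = harmonic n + 1 / of_nat (Suc n)"
  by (simp add: harmonic_def)

text \<open>
  Passing from \<open>p\<close> to \<open>p + 1\<close> would multiply the sum by \<open>1 + v\<close> by Pascal's rule, were it not that
  the shifted summand carries \<open>H\<^sub>k\<close> where \<open>H\<^sub>k\<^sub>+\<^sub>1\<close> is wanted. The difference contributes
  \<open>(p choose k) / (k + 1) = (p + 1 choose k + 1) / (p + 1)\<close>, and these correction terms add up by
  the binomial theorem.
\<close>

lemma harmonic_binomial_step:
  fixes v :: "'a :: field_char_0"
  shows "(\<Sum>k\<le>Suc p. of_nat (Suc p choose k) * harmonic k * v ^ k) =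
    (1 + v) * (\<Sum>k\<le>p. of_nat (p choose k) * harmonic k * v ^ k)
      + ((1 + v) ^ Suc p - 1) / of_nat (Suc p)"
proof -
  have coeff: "of_nat (p choose k) * harmonic (Suc k)
      = of_nat (p choose k) * harmonic k + of_nat (Suc p choose Suc k) / (of_nat (Suc p) :: 'a)" for k
  proof -
    have "of_nat (Suc k) * of_nat (Suc p choose Suc k) = (of_nat (Suc p) * of_nat (p choose k) :: 'a)"
      using Suc_times_binomial[of k p] by (metis of_nat_mult)
    then have "of_nat (p choose k) / (of_nat (Suc k) :: 'a) = of_nat (Suc p choose Suc k) / of_nat (Suc p)"
      by (simp add: frac_eq_eq mult.commute del: of_nat_Suc binomial_Suc_Suc)
    then show ?thesis
      by (simp add: harmonic_Suc distrib_left del: of_nat_Suc binomial_Suc_Suc)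
  qed
  let ?A = "\<lambda>k. of_nat (p choose k) * harmonic k * v ^ k"
  have high: "(\<Sum>k\<le>p. of_nat (p choose Suc k) * harmonic (Suc k) * v ^ Suc k) = (\<Sum>k\<le>p. ?A k)"
  proof -
    have "(\<Sum>k\<le>Suc p. ?A k) = (\<Sum>k\<le>p. ?A (Suc k))"
      by (subst sum.atMost_Suc_shift) (simp add: harmonic_def)
    then show ?thesis by (simp add: binomial_eq_0)
  qed
  have pow: "(\<Sum>k\<le>p. of_nat (Suc p choose Suc k) * v ^ Suc k) = (1 + v) ^ Suc p - 1"
    using binomial_ring[of v 1 "Suc p"]
    by (subst (asm) sum.atMost_Suc_shift) (simp add: add.commute)
  have "(\<Sum>k\<le>Suc p. of_nat (Suc p choose k) * harmonic k * v ^ k)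
      = (\<Sum>k\<le>p. of_nat (Suc p choose Suc k) * harmonic (Suc k) * v ^ Suc k)"
    by (subst sum.atMost_Suc_shift) (simp add: harmonic_def)
  also have "\<dots> = (\<Sum>k\<le>p. of_nat (p choose k) * harmonic (Suc k) * v ^ Suc k)
      + (\<Sum>k\<le>p. of_nat (p choose Suc k) * harmonic (Suc k) * v ^ Suc k)"
    by (simp add: distrib_right sum.distrib)
  also have "(\<Sum>k\<le>p. of_nat (p choose k) * harmonic (Suc k) * v ^ Suc k)
      = v * (\<Sum>k\<le>p. ?A k) + (\<Sum>k\<le>p. of_nat (Suc p choose Suc k) * v ^ Suc k) / of_nat (Suc p)"
    unfolding coeff sum_distrib_left sum_divide_distrib sum.distrib[symmetric]
    by (intro sum.cong) (simp_all add: algebra_simps del: of_nat_Suc binomial_Suc_Suc)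
  finally show ?thesis
    unfolding high pow by (simp add: algebra_simps del: of_nat_Suc)
qed

text \<open>
  Both sides satisfy the Horner rule. On the right, the step from \<open>H\<^sub>p\<close> to \<open>H\<^sub>p\<^sub>+\<^sub>1\<close> absorbs the power
  of \<open>1 + v\<close> in the correction term of \<open>harmonic_binomial_step\<close>, and the \<open>- 1\<close> there leaves the
  constant \<open>1 / (p + 1)\<close>.
\<close>

lemma harmonic_poly_binomial:
  fixes v :: "'a :: field_char_0"
  shows "harmonic_poly p (1 + v) =
    harmonic p * (1 + v) ^ p - (\<Sum>k\<le>p. of_nat (p choose k) * harmonic k * v ^ k)"
proof (induction p)
  case 0
  show ?case by (simp add: harmonic_def)
next
  case (Suc p)
  show ?case
    unfolding harmonic_poly_Suc Suc.IH harmonic_binomial_step harmonic_Suc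
    by (simp add: algebra_simps add_divide_distrib diff_divide_distrib del: of_nat_Suc)
qed

section \<open>The differential recurrence of the closed form\<close>

definition recip_exp_m1 :: "real fls" where
  "recip_exp_m1 = inverse (fls_exp 1 - 1)"

lemma fls_exp_m1_nonzero: "fls_exp 1 - 1 \<noteq> 0"
proof -
  have "fps_nth (fps_exp 1 - 1 :: real fps) 1 \<noteq> 0"
    by simp
  then have "(fps_exp 1 - 1 :: real fps) \<noteq> 0"
    by (metis fps_zero_nth)
  then show ?thesis
    by (metis fps_one_to_fls fps_to_fls_eq_0_iff fps_to_fls_minus)
qed

lemma fls_exp_times_recip: "fls_exp 1 * recip_exp_m1 = 1 + recip_exp_m1"
  using fls_exp_m1_nonzero by (simp add: recip_exp_m1_def field_simps)

lemma fls_deriv_recip_exp_m1: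
  "fls_deriv recip_exp_m1 = - recip_exp_m1 * (1 + recip_exp_m1)"
proof -
  have "fls_deriv recip_exp_m1 = - fls_exp 1 * recip_exp_m1\<^sup>2"
    unfolding recip_exp_m1_def
    by (subst fls_inverse_deriv) (simp_all add: fls_deriv_fps_to_fls)
  then show ?thesis
    using fls_exp_times_recip by (simp add: power2_eq_square algebra_simps)
qed

text \<open>
  The first closed form divided by \<open>p + 1\<close>, in terms of \<open>v\<close> and \<open>w = 1 + v\<close>: this normalisation
  is what makes the recurrence in \<open>p\<close> a Horner rule.
\<close>

definition closed_form :: "nat \<Rightarrow> real fls" where
  "closed_form p = recip_exp_m1 *
     (fls_X * (1 + recip_exp_m1) ^ p - harmonic_poly p (1 + recip_exp_m1))"

lemma closed_form_Suc:
  "closed_form (Suc p) = (1 + recip_exp_m1) * closed_form p - recip_exp_m1 / of_nat (Suc p)"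
  by (simp add: closed_form_def harmonic_poly_Suc algebra_simps del: of_nat_Suc)

text \<open>
  This is the differential recurrence with \<open>closed_form (Suc p)\<close> eliminated by the Horner rule. Only
  one member of the sequence occurs here, so the induction step just differentiates
  \<open>closed_form_Suc\<close>.
\<close>

lemma fls_deriv_closed_form:
  "fls_deriv (closed_form p) = of_nat p * closed_form p
     - of_nat (Suc p) * (1 + recip_exp_m1) * closed_form p + recip_exp_m1"
proof (induction p)
  case 0
  show ?case
    by (simp add: closed_form_def fls_deriv_recip_exp_m1 algebra_simps)
next
  case (Suc p)
  define v where "v = recip_exp_m1"
  define g where "g = closed_form p"
  define c :: "real fls" where "c = 1 / of_nat (Suc p)"
  define N :: "real fls" where "N = of_nat (Suc p)"
  have c: "N * c = 1" "fls_deriv c = 0"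
    by (simp_all add: c_def N_def fls_of_nat fls_const_divide_const flip: fls_const_1 del: of_nat_Suc)
  have dv: "fls_deriv v = - v * (1 + v)"
    unfolding v_def by (rule fls_deriv_recip_exp_m1)
  have g': "closed_form (Suc p) = (1 + v) * g - c * v"
    by (simp add: closed_form_Suc g_def v_def c_def)
  have IH: "fls_deriv g = (N - 1) * g - N * (1 + v) * g + v"
    using Suc.IH by (simp add: g_def v_def N_def)
  have N2: "of_nat (Suc (Suc p)) = N + 1"
    by (simp add: N_def)
  \<comment> \<open>All terms in \<open>g\<close> cancel, and the rest vanishes because of \<open>N * c = 1\<close>.\<close>
  have "fls_deriv (closed_form (Suc p)) - (of_nat (Suc p) * closed_form (Suc p)
     - of_nat (Suc (Suc p)) * (1 + v) * closed_form (Suc p) + v)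
     = (N * c - 1) * (- v * v)"
    unfolding g' N2 N_def[symmetric]
    by (simp add: IH dv c(2) algebra_simps)
  then show ?case
    using c(1) by (simp add: v_def)
qed

lemma closed_form_differential_recurrence:
  "of_nat (Suc p) * closed_form (Suc p) = of_nat p * closed_form p - fls_deriv (closed_form p)"
  by (simp add: fls_deriv_closed_form closed_form_Suc algebra_simps del: of_nat_Suc)

section \<open>The generating function of the \<open>p\<close>-Bernoulli numbers\<close>

lemma fps_deriv_p_bernoulli_egf:
  assumes "p_bernoulli_numbers B"
  shows "fps_deriv (p_bernoulli_egf B p) = fps_const (real p) * p_bernoulli_egf B p
    - fps_const ((real p + 1)\<^sup>2 / (real p + 2)) * p_bernoulli_egf B (Suc p)"
proof (rule fps_ext)
  fix n
  have "B (Suc n) p = real p * B n p - (real p + 1)\<^sup>2 / (real p + 2) * B n (Suc p)"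
    using assms unfolding p_bernoulli_numbers_def by blast
  then have "B (Suc n) p / fact n
      = real p * (B n p / fact n) - (real p + 1)\<^sup>2 / (real p + 2) * (B n (Suc p) / fact n)"
    by (simp add: diff_divide_distrib)
  then show "fps_nth (fps_deriv (p_bernoulli_egf B p)) n =
      fps_nth (fps_const (real p) * p_bernoulli_egf B p
        - fps_const ((real p + 1)\<^sup>2 / (real p + 2)) * p_bernoulli_egf B (Suc p)) n"
    by (simp add: p_bernoulli_egf_def del: of_nat_Suc)
qed

lemma p_bernoulli_egf_0:
  assumes "p_bernoulli_numbers B"
  shows "fps_to_fls (p_bernoulli_egf B 0) = closed_form 0"
proof -
  have sub: "subdegree (fps_exp 1 - 1 :: real fps) = 1"
    by (intro subdegreeI) auto
  have "p_bernoulli_egf B 0 = fps_X / (fps_exp 1 - 1)"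
    using assms
    by (intro fps_ext) (simp add: p_bernoulli_egf_def p_bernoulli_numbers_def bernoulli_number_def)
  then show ?thesis
    using fls_divide_fps_to_fls[of "fps_exp 1 - 1 :: real fps" fps_X]
    by (simp only: sub subdegree_fps_X order.refl fps_to_fls_minus fps_one_to_fls fps_X_to_fls)
       (simp add: closed_form_def recip_exp_m1_def divide_inverse mult.commute)
qed

text \<open>
  The coefficient of \<open>f\<^sub>p\<^sub>+\<^sub>1\<close> in the derivative of \<open>f\<^sub>p\<close> does not vanish, so \<open>f\<^sub>p\<close> determines
  \<open>f\<^sub>p\<^sub>+\<^sub>1\<close>; the factor \<open>(p + 1)\<^sup>2 / (p + 2)\<close> is exactly the one which the normalisation by
  \<open>p + 1\<close> turns into \<open>p + 1\<close>.
\<close>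

lemma p_bernoulli_egf_eq_closed_form:
  assumes "p_bernoulli_numbers B"
  shows "fps_to_fls (p_bernoulli_egf B p) = of_nat (Suc p) * closed_form p"
proof (induction p)
  case 0
  show ?case using p_bernoulli_egf_0[OF assms] by simp
next
  case (Suc p)
  define c where "c = (real p + 1)\<^sup>2 / (real p + 2)"
  have d: "real p + 2 \<noteq> 0" "real p + 1 \<noteq> 0"
    by linarith+
  have c: "c \<noteq> 0" "c * real (Suc (Suc p)) = real (Suc p) * real (Suc p)"
    using d by (simp add: c_def) (use d in \<open>simp add: c_def power2_eq_square field_simps\<close>)
  have "fls_const c * fps_to_fls (p_bernoulli_egf B (Suc p))
      = of_nat p * fps_to_fls (p_bernoulli_egf B p) - fls_deriv (fps_to_fls (p_bernoulli_egf B p))"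
    unfolding fls_deriv_fps_to_fls fps_deriv_p_bernoulli_egf[OF assms]
    by (simp add: fls_times_fps_to_fls fls_of_nat c_def)
  also have "\<dots> = of_nat (Suc p) * (of_nat p * closed_form p - fls_deriv (closed_form p))"
    unfolding Suc.IH by (simp add: algebra_simps)
  also have "\<dots> = of_nat (Suc p) * of_nat (Suc p) * closed_form (Suc p)"
    unfolding closed_form_differential_recurrence[symmetric] by (simp only: mult.assoc)
  also have "\<dots> = fls_const c * (of_nat (Suc (Suc p)) * closed_form (Suc p))"
    using c(2) unfolding fls_of_nat mult.assoc[symmetric] fls_const_mult_const by simp
  finally show ?case
    using c(1) by (simp del: of_nat_Suc)
qed

section \<open>Translation to exponentials\<close>

lemma fls_exp_real: "fls_exp (real n) = fls_exp 1 ^ n"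
  by (simp add: fps_exp_power_mult flip: fps_to_fls_power)

lemma fls_exp_over_power: "fls_exp (real n) / (fls_exp 1 - 1) ^ (n + 1)
    = recip_exp_m1 * (1 + recip_exp_m1) ^ n"
  unfolding fls_exp_times_recip[symmetric] fls_exp_real
  by (simp add: recip_exp_m1_def divide_inverse power_mult_distrib power_inverse)

lemma fls_const_harm: "fls_const (harm n) = (harmonic n :: real fls)"
proof (induction n)
  case 0
  show ?case by (simp add: harm_def harmonic_def)
next
  case (Suc n)
  have "fls_const (inverse (real (Suc n))) = 1 / of_nat (Suc n)"
    by (simp add: fls_of_nat fls_const_divide_const inverse_eq_divide flip: fls_const_1 del: of_nat_Suc)
  then show ?case
    using Suc by (simp add: harm_Suc harmonic_Suc del: of_nat_Suc flip: fls_plus_const)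
qed

theorem corollary1:
  fixes B :: "nat \<Rightarrow> nat \<Rightarrow> real" and p :: nat
  assumes "p_bernoulli_numbers B"
  shows "fps_to_fls (p_bernoulli_egf B p) =
           fls_const (real p + 1) * fls_X * fls_exp (real p) / (fls_exp 1 - 1) ^ (p + 1)
           - fls_const (real p + 1) *
             (\<Sum>k = 1..p. fls_const (1 / real k) *
                (fls_exp (real (p - k)) / (fls_exp 1 - 1) ^ (p - k + 1)))
    \<and>  fls_const (real p + 1) * fls_X * fls_exp (real p) / (fls_exp 1 - 1) ^ (p + 1)
           - fls_const (real p + 1) *
             (\<Sum>k = 1..p. fls_const (1 / real k) *
                (fls_exp (real (p - k)) / (fls_exp 1 - 1) ^ (p - k + 1))) =
         fls_const (real p + 1) * fls_exp (real p) * (fls_X - fls_const (harm p))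
             / (fls_exp 1 - 1) ^ (p + 1)
           + fls_const (real p + 1) *
             (\<Sum>k = 1..p. fls_const (real (p choose k)) *
                (fls_const (harm k) / (fls_exp 1 - 1) ^ (k + 1)))"
    (is "?f = ?first \<and> ?first = ?second")
proof -
  define v where "v = recip_exp_m1"
  define c where "c = fls_const (real p + 1)"
  have c: "c = of_nat (Suc p)"
    by (simp add: c_def fls_of_nat add.commute del: of_nat_Suc) simp
  \<comment> \<open>The leading terms of the two forms are the instances \<open>x = t\<close> and \<open>x = t - H\<^sub>p\<close>.\<close>
  have lead: "c * x * fls_exp (real p) / (fls_exp 1 - 1) ^ (p + 1) = c * (v * (x * (1 + v) ^ p))" for x
  proof -
    have "c * x * fls_exp (real p) / (fls_exp 1 - 1) ^ (p + 1)
        = c * x * (fls_exp (real p) / (fls_exp 1 - 1) ^ (p + 1))"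
      by (rule times_divide_eq_right[symmetric])
    then show ?thesis
      unfolding fls_exp_over_power v_def by (simp add: algebra_simps)
  qed
  have sum1: "(\<Sum>k = 1..p. fls_const (1 / real k) *
      (fls_exp (real (p - k)) / (fls_exp 1 - 1) ^ (p - k + 1))) = v * harmonic_poly p (1 + v)"
    unfolding fls_exp_over_power harmonic_poly_def sum_distrib_left v_def
    by (intro sum.cong refl)
       (simp add: fls_of_nat flip: fls_const_divide_const)
  have sum2: "(\<Sum>k = 1..p. fls_const (real (p choose k)) *
      (fls_const (harm k) / (fls_exp 1 - 1) ^ (k + 1)))
      = v * (\<Sum>k\<le>p. of_nat (p choose k) * harmonic k * v ^ k)"
  proof -
    \<comment> \<open>The summand for \<open>k = 0\<close> vanishes because \<open>H\<^sub>0 = 0\<close>.\<close>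
    have "(\<Sum>k\<le>p. of_nat (p choose k) * harmonic k * v ^ k)
        = (\<Sum>k = 1..p. of_nat (p choose k) * harmonic k * v ^ k)"
      by (intro sum.mono_neutral_right) (auto simp: harmonic_def Suc_le_eq)
    then show ?thesis
      by (simp only: sum_distrib_left, intro sum.cong refl)
         (simp add: fls_const_harm fls_of_nat v_def recip_exp_m1_def divide_inverse power_inverse)
  qed
  have first: "?first = c * closed_form p"
    unfolding c_def[symmetric] lead sum1
    by (simp add: closed_form_def v_def algebra_simps)
  have "?second = c * (v * ((fls_X - fls_const (harm p)) * (1 + v) ^ p))
      + c * (v * (\<Sum>k\<le>p. of_nat (p choose k) * harmonic k * v ^ k))"
    unfolding c_def[symmetric] sum2 using lead[of "fls_X - fls_const (harm p)"]
    by (simp only: mult.assoc mult.commute[of "fls_exp (real p)"])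
  also have "\<dots> = c * closed_form p"
    unfolding closed_form_def v_def[symmetric] harmonic_poly_binomial fls_const_harm
    by (simp add: algebra_simps)
  finally have second: "?second = c * closed_form p" .
  show ?thesis
    unfolding first second p_bernoulli_egf_eq_closed_form[OF assms] c by simp
qed

end
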